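(* Let $a_i^-\le a_i^+$ ($i=1,2,3,4$) be real numbers such that every polynomial in the interval family $K=\{s^4+a_1s^3+a_2s^2+a_3s+a_4 : a_i\in[a_i^-,a_i^+],\ i=1,2,3,4\}$ is Hurwitz stable. Let $F=\{a_1(s),a_2(s),a_3(s),a_4(s)\}$ be the set of the four Kharitonov vertex polynomials of $K$, $$a_1(s)=s^4+a_1^{+}s^3+a_2^{+}s^2+a_3^{-}s+a_4^{-},$$ $$a_2(s)=s^4+a_1^{-}s^3+a_2^{-}s^2+a_3^{+}s+a_4^{+},$$ $$a_3(s)=s^4+a_1^{+}s^3+a_2^{-}s^2+a_3^{-}s+a_4^{+},$$ $$a_4(s)=s^4+a_1^{-}s^3+a_2^{+}s^2+a_3^{+}s+a_4^{-}.$$ Then there exists a fixed real polynomial $b(s)$ such that $b(s)/a(s)$ is strictly positive real for every $a(s)\in F$.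
   Context: A real polynomial is Hurwitz stable if all its complex roots have negative real part. A rational function $f(s)=p(s)/q(s)$, with $p,q$ real polynomials, that is biproper (i.e. $\deg p=\deg q$) is called strictly positive real (SPR) if (i) $f$ is analytic in $\mathrm{Re}[s]\ge 0$, i.e. $q$ is Hurwitz stable; and (ii) $\mathrm{Re}[f(j\omega)]>0$ for all $\omega\in\mathbb{R}$, where $j=\sqrt{-1}$. (In particular, strict positive realness of $b/a$ includes the requirement $\deg b=\deg a$.) *)

theory Defs
  imports Complex_Main "HOL-Computational_Algebra.Polynomial"
begin

definition hurwitz_stable :: "real poly \<Rightarrow> bool" where
  "hurwitz_stable p \<longleftrightarrow>
    (\<forall>z::complex. poly (map_poly complex_of_real p) z = 0 \<longrightarrow> Re z < 0)"

(* The rational function p/q is represented by the pair (p, q), which need not be coprime;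
   its analyticity in the closed right half-plane is expressed by stability of q, which
   also forces q to be nonzero and makes the division below proper. *)
definition strictly_positive_real :: "real poly \<Rightarrow> real poly \<Rightarrow> bool" where
  "strictly_positive_real p q \<longleftrightarrow>
    degree p = degree q \<and>
    hurwitz_stable q \<and>
    (\<forall>w::real. Re (poly (map_poly complex_of_real p) (\<i> * complex_of_real w) /
                   poly (map_poly complex_of_real q) (\<i> * complex_of_real w)) > 0)"

(* s^4 + a1 s^3 + a2 s^2 + a3 s + a4; coefficient lists start with the constant term. *)
definition monic_quartic :: "real \<Rightarrow> real \<Rightarrow> real \<Rightarrow> real \<Rightarrow> real poly" where
  "monic_quartic a1 a2 a3 a4 = [:a4, a3, a2, a1, 1:]"

(* In the next two definitions only the values of the bounds at 1, 2, 3, 4 matter. *)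
definition interval_family :: "(nat \<Rightarrow> real) \<Rightarrow> (nat \<Rightarrow> real) \<Rightarrow> real poly set" where
  "interval_family lo hi =
    {monic_quartic (a 1) (a 2) (a 3) (a 4) | a. \<forall>i\<in>{1..4}. a i \<in> {lo i..hi i}}"

definition kharitonov_vertices :: "(nat \<Rightarrow> real) \<Rightarrow> (nat \<Rightarrow> real) \<Rightarrow> real poly set" where
  "kharitonov_vertices lo hi =
    {monic_quartic (hi 1) (hi 2) (lo 3) (lo 4),
     monic_quartic (lo 1) (lo 2) (hi 3) (hi 4),
     monic_quartic (hi 1) (lo 2) (lo 3) (hi 4),
     monic_quartic (lo 1) (hi 2) (hi 3) (lo 4)}"

end

theory Submission
  imports Defs "HOL-Computational_Algebra.Fundamental_Theorem_Algebra"
begin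

text \<open>
  Write \<open>s = \<i> w\<close> and \<open>x = w\<^sup>2\<close>. A quartic \<open>a\<close> of the family takes there the value \<open>e + \<i> w d\<close> with
  \<open>e = x\<^sup>2 - a2 x + a4\<close> and \<open>d = a3 - a1 x\<close>. For the cubic \<open>c = s\<^sup>3 + X s\<^sup>2 + y s\<close> the real part of
  \<open>c\<close> times the conjugate of \<open>a\<close> is \<open>x ((y - x) d - X e)\<close>. So the heart of the matter is to find
  \<open>X > 0\<close> and \<open>y\<close> such that \<open>(y - x) d - X e\<close> is positive for all \<open>x \<ge> 0\<close> and for all members of
  the family at once.

  Because \<open>X > 0\<close>, only the largest even part \<open>E = x\<^sup>2 - lo 2 x + hi 4\<close> matters. Because the
  expression is linear in \<open>d\<close>, only the extreme odd parts matter: \<open>lo 3 - hi 1 x\<close> to the left of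
  \<open>y\<close> and \<open>hi 3 - lo 1 x\<close> to the right of it. The Routh-Hurwitz inequality for the two vertices
  with even part \<open>E\<close> says that \<open>E\<close> is negative at the zeros of both extreme odd parts. Hence these
  zeros \<open>\<omega>1 \<le> \<omega>2\<close> lie strictly between the zeros \<open>\<beta>1 < \<beta>2\<close> of \<open>E\<close>. What remains is a pair of
  quadratic inequalities
  \<open>hi 1 (x - y) (x - \<omega>1) > X E\<close> and \<open>lo 1 (x - y) (x - \<omega>2) > X E\<close>.
  For a quadratic \<open>(x - y) (x - \<omega>)\<close> with zeros between \<open>\<beta>1\<close> and \<open>\<beta>2\<close>, the form
  \<open>(x - y) (x - \<omega>) - \<lambda> E\<close> is positive definite exactly for \<open>\<lambda>\<close> strictly between the two zeros of
  its discriminant. Their geometric mean is \<open>\<bar>y - \<omega>\<bar> / (\<beta>2 - \<beta>1)\<close>, hence an admissible choice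
  if \<open>y \<noteq> \<omega>\<close> (\<open>interlacing_form_pos\<close>). Taking this choice in both inequalities forces
  \<open>hi 1 (y - \<omega>1) = lo 1 (\<omega>2 - y)\<close>. This equation determines \<open>y\<close> as a weighted mean of \<open>\<omega>1\<close> and
  \<open>\<omega>2\<close>, and then \<open>X\<close> (\<open>common_multiplier\<close>). If \<open>\<omega>1 = \<omega>2\<close>, then \<open>\<omega>1\<close> is first lowered a
  little, so that \<open>X > 0\<close>.

  Finally \<open>b = \<epsilon> s\<^sup>4 + c + \<epsilon>\<close> has the right degree and is nonzero at \<open>s = 0\<close>. The positivity of the
  quadratics is uniform, with margin \<open>\<eta> (1 + x\<^sup>2)\<close>, and so it absorbs the perturbation for small \<open>\<epsilon>\<close>
  (\<open>strictly_positive_real_quartic\<close>). The resulting \<open>b\<close> serves the whole interval family.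
\<close>

section \<open>The Routh-Hurwitz inequality for quartics\<close>

abbreviation cpoly :: "real poly \<Rightarrow> complex poly" where
  "cpoly \<equiv> map_poly complex_of_real"

lemma cpoly_pCons: "cpoly (pCons c p) = pCons (of_real c) (cpoly p)"
  by (simp add: map_poly_pCons)

lemma poly_cpoly_add: "poly (cpoly (p + q)) z = poly (cpoly p) z + poly (cpoly q) z"
proof -
  have "cpoly (p + q) = cpoly p + cpoly q"
    by (simp add: poly_eq_iff coeff_map_poly)
  then show ?thesis by simp
qed

lemma poly_cpoly_mult: "poly (cpoly (p * q)) z = poly (cpoly p) z * poly (cpoly q) z"
  by (induction p) (simp_all add: cpoly_pCons poly_cpoly_add map_poly_smult algebra_simps)

lemma poly_cpoly_of_real: "poly (cpoly p) (of_real t) = of_real (poly p t)"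
  by (induction p) (simp_all add: cpoly_pCons)

lemma degree_cpoly: "degree (cpoly p) = degree p"
  by (simp add: degree_map_poly)

lemma nonreal_root_imp_quadratic_dvd:
  fixes p :: "real poly"
  assumes root: "poly (cpoly p) z = 0" and nonreal: "Im z \<noteq> 0"
  shows "[:(Re z)\<^sup>2 + (Im z)\<^sup>2, - 2 * Re z, 1:] dvd p"
proof -
  define Q where "Q = [:(Re z)\<^sup>2 + (Im z)\<^sup>2, - 2 * Re z, 1:]"
  have "Q \<noteq> 0" "degree Q = 2" by (simp_all add: Q_def)
  have "degree (p mod Q) < 2 \<or> p mod Q = 0"
    using degree_mod_less[OF \<open>Q \<noteq> 0\<close>, of p] \<open>degree Q = 2\<close> by auto
  then have "degree (p mod Q) \<le> 1" by auto
  then obtain c d where r: "p mod Q = [:c, d:]"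
    by (metis One_nat_def degree1_coeffs degree_0_id le_Suc_eq le_zero_eq pCons_0_0 degree_eq_zeroE)
  have "poly (cpoly Q) z = 0"
    by (simp add: Q_def cpoly_pCons complex_eq_iff power2_eq_square algebra_simps)
  then have "poly (cpoly (p mod Q)) z = 0"
    using root poly_cpoly_add[of "p div Q * Q" "p mod Q" z] poly_cpoly_mult[of "p div Q" Q z]
    by simp
  then have "p mod Q = 0"
    using nonreal by (auto simp: r cpoly_pCons complex_eq_iff)
  then show ?thesis
    unfolding Q_def by (simp add: mod_eq_0_iff_dvd)
qed

text \<open>
  Either some root of the polynomial is not real, and pairing it with its conjugate gives the
  factor, or two real roots can be split off one after the other.
\<close>
lemma real_quadratic_factor:
  fixes p :: "real poly"
  assumes "degree p \<ge> 2"
  shows "\<exists>u v. [:v, u, 1:] dvd p"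
proof -
  have root: "\<exists>z. poly (cpoly q) z = 0" if "degree q \<ge> 1" for q :: "real poly"
    using fundamental_theorem_of_algebra[of "cpoly q"] that
    by (simp add: constant_degree degree_cpoly)
  obtain z where z: "poly (cpoly p) z = 0"
    using root[of p] assms by auto
  show ?thesis
  proof (cases "Im z = 0")
    case False
    then show ?thesis using nonreal_root_imp_quadratic_dvd[OF z] by blast
  next
    case True
    then have "z = of_real (Re z)" by (simp add: complex_eq_iff)
    then have "poly p (Re z) = 0"
      using z poly_cpoly_of_real[of p "Re z"] by simp
    then obtain q where p: "p = [:- Re z, 1:] * q"
      by (auto simp: poly_eq_0_iff_dvd)
    have "q \<noteq> 0" using p assms by auto
    then have "degree q \<ge> 1"
      using assms unfolding p by (subst (asm) degree_mult_eq) auto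
    then obtain y where y: "poly (cpoly q) y = 0"
      using root by blast
    show ?thesis
    proof (cases "Im y = 0")
      case False
      then have "[:(Re y)\<^sup>2 + (Im y)\<^sup>2, - 2 * Re y, 1:] dvd q"
        using nonreal_root_imp_quadratic_dvd[OF y] by blast
      then show ?thesis using p dvd_mult by blast
    next
      case True
      then have "y = of_real (Re y)" by (simp add: complex_eq_iff)
      then have "poly q (Re y) = 0"
        using y poly_cpoly_of_real[of q "Re y"] by simp
      then obtain h where q: "q = [:- Re y, 1:] * h"
        by (auto simp: poly_eq_0_iff_dvd)
      have "p = ([:- Re z, 1:] * [:- Re y, 1:]) * h"
        by (simp only: p q mult.assoc)
      also have "[:- Re z, 1:] * [:- Re y, 1:] = [:Re z * Re y, - Re z - Re y, 1:]"
        by simp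
      finally have "[:Re z * Re y, - Re z - Re y, 1:] dvd p" by (rule dvdI)
      then show ?thesis by blast
    qed
  qed
qed

lemma hurwitz_stable_dvd:
  assumes "hurwitz_stable p" "q dvd p"
  shows "hurwitz_stable q"
  using assms by (auto simp: hurwitz_stable_def poly_cpoly_mult elim!: dvdE)

lemma hurwitz_stable_quadratic:
  assumes stable: "hurwitz_stable [:v, u, 1:]"
  shows "u > 0 \<and> v > 0"
proof (cases "u\<^sup>2 - 4 * v \<ge> 0")
  case True
  define D where "D = sqrt (u\<^sup>2 - 4 * v)"
  have D: "D \<ge> 0" "D * D = u * u - 4 * v"
    using True by (simp_all add: D_def power2_eq_square)
  define x where "x = (- u + D) / 2"
  have "x * x + u * x + v = 0"
    using D(2) by (simp add: x_def field_simps)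
  then have "poly (cpoly [:v, u, 1:]) (of_real x) = 0"
    unfolding poly_cpoly_of_real by (simp add: algebra_simps)
  then have "x < 0"
    using stable unfolding hurwitz_stable_def by force
  then have "D < u" by (simp add: x_def)
  moreover from this have "D * D < u * u"
    using D(1) by (simp add: mult_strict_mono)
  ultimately show ?thesis using D by linarith
next
  case False
  define D where "D = sqrt (4 * v - u\<^sup>2)"
  have D: "D * D = 4 * v - u * u"
    using False by (simp add: D_def power2_eq_square)
  have "poly (cpoly [:v, u, 1:]) (Complex (- u / 2) (D / 2)) = 0"
    using D by (simp add: cpoly_pCons complex_eq_iff field_simps)
  then have "- u / 2 < 0"
    using stable unfolding hurwitz_stable_def by fastforce
  moreover have "v > 0"
    using False zero_le_power2[of u] by linarith
  ultimately show ?thesis by simp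
qed

text \<open>
  Only the necessity of the Routh-Hurwitz criterion is proved. A factorisation into two real
  quadratics reduces it to degree two, because the coefficients of the stable quadratics are
  positive and all five expressions are then visibly positive in terms of them.
\<close>
lemma hurwitz_stable_quartic:
  assumes stable: "hurwitz_stable (monic_quartic a1 a2 a3 a4)"
  shows "a1 > 0" "a2 > 0" "a3 > 0" "a4 > 0" "a3\<^sup>2 + a1\<^sup>2 * a4 < a1 * a2 * a3"
proof -
  let ?p = "monic_quartic a1 a2 a3 a4"
  have deg: "degree ?p = 4" by (simp add: monic_quartic_def)
  obtain u v where "[:v, u, 1:] dvd ?p"
    using real_quadratic_factor[of ?p] deg by auto
  then obtain h where p: "?p = [:v, u, 1:] * h" by (elim dvdE)
  have "h \<noteq> 0" using p deg by auto
  then have "degree h = 2"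
    using deg unfolding p by (subst (asm) degree_mult_eq) auto
  then obtain t r k where h: "h = [:t, r, k:]"
    by (metis degree2_coeffs)
  have coeffs: "k = 1" "a1 = u + r" "a2 = v + u * r + t" "a3 = u * t + v * r" "a4 = v * t"
    using p by (auto simp: h monic_quartic_def algebra_simps)
  have "hurwitz_stable [:v, u, 1:]" "hurwitz_stable [:t, r, 1:]"
    using hurwitz_stable_dvd[OF stable] p h coeffs(1) by (metis dvd_triv_left, metis dvd_triv_right)
  then have pos: "u > 0" "v > 0" "r > 0" "t > 0"
    using hurwitz_stable_quadratic by blast+
  show "a1 > 0" "a2 > 0" "a3 > 0" "a4 > 0"
    using pos by (simp_all add: coeffs add_pos_pos)
  have "a1 * a2 * a3 - (a3\<^sup>2 + a1\<^sup>2 * a4) = u * r * ((v - t)\<^sup>2 + (u + r) * (u * t + v * r))"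
    unfolding coeffs by (simp add: power2_eq_square algebra_simps)
  also have "\<dots> > 0"
    using pos by (intro mult_pos_pos add_nonneg_pos add_pos_pos) auto
  finally show "a3\<^sup>2 + a1\<^sup>2 * a4 < a1 * a2 * a3" by simp
qed

section \<open>A common quadratic certificate\<close>

text \<open>
  The projective coordinate \<open>t = (x - \<beta>1) / (\<beta>2 - x)\<close> sends \<open>\<beta>1, \<beta>2\<close> to \<open>0, \<infinity>\<close> and
  \<open>\<omega>, y\<close> to some \<open>0 < \<tau> < T\<close>. Up to positive factors the difference of the two sides becomes
  \<open>(t - T) (t - \<tau>) + (T - \<tau>) t = (t - \<tau>)\<^sup>2 + \<tau> (T - \<tau>)\<close>. The proof uses this identity with
  denominators cleared.
\<close>
lemma interlacing_form_pos:
  fixes \<beta>1 \<beta>2 \<omega> y x :: real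
  assumes "\<beta>1 < \<omega>" "\<omega> < y" "y < \<beta>2"
  shows "(y - \<omega>) * ((x - \<beta>1) * (x - \<beta>2)) < (\<beta>2 - \<beta>1) * ((x - y) * (x - \<omega>))"
proof -
  let ?N = "(\<beta>2 - \<beta>1) * ((x - y) * (x - \<omega>)) - (y - \<omega>) * ((x - \<beta>1) * (x - \<beta>2))"
  have "(\<beta>2 - \<omega>) * (\<beta>2 - \<beta>1) * ?N =
      (\<beta>2 - y) * ((\<beta>2 - \<beta>1) * (x - \<omega>))\<^sup>2 + (\<omega> - \<beta>1) * (y - \<omega>) * (\<beta>2 - \<beta>1) * (\<beta>2 - x)\<^sup>2"
    by (simp add: power2_eq_square algebra_simps)
  also have "\<dots> > 0"
  proof (cases "x = \<omega>")
    case True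
    then show ?thesis using assms by simp
  next
    case False
    then show ?thesis
      using assms by (intro add_pos_nonneg mult_pos_pos mult_nonneg_nonneg) auto
  qed
  finally have "(\<beta>2 - \<omega>) * (\<beta>2 - \<beta>1) * ?N > 0" .
  moreover have "(\<beta>2 - \<omega>) * (\<beta>2 - \<beta>1) > 0" using assms by simp
  ultimately have "?N > 0" by (metis zero_less_mult_pos)
  then show ?thesis by simp
qed

text \<open>
  The margin \<open>\<eta>\<close> is the linearised solution of the discriminant condition
  \<open>\<beta>\<^sup>2 \<le> 4 (\<alpha> - \<eta>) (\<gamma> - \<eta>)\<close>, in which dropping \<open>\<eta>\<^sup>2\<close> errs on the safe side.
\<close>
lemma pos_quadratic_uniform:
  fixes \<alpha> \<beta> \<gamma> :: real
  assumes lead: "\<alpha> > 0" and pos: "\<And>x. \<alpha> * x\<^sup>2 + \<beta> * x + \<gamma> > 0"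
  shows "\<exists>\<eta>>0. \<forall>x. \<eta> * (1 + x\<^sup>2) \<le> \<alpha> * x\<^sup>2 + \<beta> * x + \<gamma>"
proof -
  have \<gamma>: "\<gamma> > 0" using pos[of 0] by simp
  have disc: "4 * \<alpha> * \<gamma> - \<beta>\<^sup>2 > 0"
    using pos[of "- \<beta> / (2 * \<alpha>)"] lead by (simp add: field_simps power2_eq_square)
  define \<eta> where "\<eta> = (4 * \<alpha> * \<gamma> - \<beta>\<^sup>2) / (4 * (\<alpha> + \<gamma>))"
  have \<eta>: "\<eta> > 0" using disc lead \<gamma> by (simp add: \<eta>_def)
  have sum: "4 * \<eta> * (\<alpha> + \<gamma>) = 4 * \<alpha> * \<gamma> - \<beta>\<^sup>2"
  proof -
    have "\<eta> * (4 * (\<alpha> + \<gamma>)) = 4 * \<alpha> * \<gamma> - \<beta>\<^sup>2"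
      using lead \<gamma> \<eta>_def by (subst nonzero_eq_divide_eq[symmetric]) auto
    then show ?thesis by (simp only: ac_simps)
  qed
  have "\<eta> * (\<alpha> + \<gamma>) \<le> \<alpha> * \<gamma>"
    using sum zero_le_power2[of \<beta>] by linarith
  also have "\<dots> < \<alpha> * (\<alpha> + \<gamma>)" using lead by simp
  finally have less: "\<eta> < \<alpha>" using lead \<gamma> by simp
  show ?thesis
  proof (intro exI[of _ \<eta>] conjI allI \<eta>)
    fix x
    have "4 * (\<alpha> - \<eta>) * (\<alpha> * x\<^sup>2 + \<beta> * x + \<gamma> - \<eta> * (1 + x\<^sup>2))
        = (2 * (\<alpha> - \<eta>) * x + \<beta>)\<^sup>2 + (4 * \<alpha> * \<gamma> - \<beta>\<^sup>2 - 4 * \<eta> * (\<alpha> + \<gamma>)) + 4 * \<eta>\<^sup>2"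
      by (simp add: power2_eq_square algebra_simps)
    also have "\<dots> \<ge> 0" using sum by simp
    finally show "\<eta> * (1 + x\<^sup>2) \<le> \<alpha> * x\<^sup>2 + \<beta> * x + \<gamma>"
      using less by (simp add: zero_le_mult_iff)
  qed
qed

lemma interlacing_form_uniform:
  fixes \<beta>1 \<beta>2 \<omega> y m X :: real
  assumes ord: "\<beta>1 < \<omega>" "\<omega> < y" "y < \<beta>2" and m: "m > 0"
    and X: "X * (\<beta>2 - \<beta>1) = m * (y - \<omega>)"
  shows "\<exists>\<eta>>0. \<forall>x. \<eta> * (1 + x\<^sup>2) \<le> m * ((x - y) * (x - \<omega>)) - X * ((x - \<beta>1) * (x - \<beta>2))"
proof -
  have d: "\<beta>2 - \<beta>1 > 0" using ord by simp
  have eq: "m * ((x - y) * (x - \<omega>)) - X * ((x - \<beta>1) * (x - \<beta>2)) =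
      (m - X) * x\<^sup>2 + (X * (\<beta>1 + \<beta>2) - m * (y + \<omega>)) * x + (m * (y * \<omega>) - X * (\<beta>1 * \<beta>2))" for x
    by (simp add: power2_eq_square algebra_simps)
  have "X * (\<beta>2 - \<beta>1) < m * (\<beta>2 - \<beta>1)"
    unfolding X using ord m by simp
  then have lead: "m - X > 0" using d by simp
  have "m * ((x - y) * (x - \<omega>)) - X * ((x - \<beta>1) * (x - \<beta>2)) > 0" for x
  proof -
    have "(\<beta>2 - \<beta>1) * (X * ((x - \<beta>1) * (x - \<beta>2))) = m * ((y - \<omega>) * ((x - \<beta>1) * (x - \<beta>2)))"
      using X by (metis mult.assoc mult.commute)
    also have "\<dots> < m * ((\<beta>2 - \<beta>1) * ((x - y) * (x - \<omega>)))"
      using interlacing_form_pos[OF ord] m by simp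
    also have "\<dots> = (\<beta>2 - \<beta>1) * (m * ((x - y) * (x - \<omega>)))" by simp
    finally show ?thesis using d by simp
  qed
  then show ?thesis
    unfolding eq using pos_quadratic_uniform[OF lead] by blast
qed

text \<open>
  The weighted mean \<open>y\<close> is chosen so that the multipliers \<open>X\<close> prescribed by the forms with
  zeros \<open>\<omega>1, y\<close> and \<open>y, \<omega>2\<close> coincide. The first form bounds the expression from below for
  \<open>x \<le> y\<close>, where the smallest \<open>d\<close> is the worst one, and the second form does so for \<open>x > y\<close>.
\<close>
lemma common_multiplier:
  fixes \<beta>1 \<beta>2 \<omega>1 \<omega>2 m1 m2 :: real
  assumes ord: "\<beta>1 < \<omega>1" "\<omega>1 < \<omega>2" "\<omega>2 < \<beta>2" and m: "m1 > 0" "m2 > 0"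
  shows "\<exists>X>0. \<exists>y. \<exists>\<eta>>0. \<forall>x e d.
    e \<le> (x - \<beta>1) * (x - \<beta>2) \<longrightarrow> m1 * (\<omega>1 - x) \<le> d \<longrightarrow> d \<le> m2 * (\<omega>2 - x) \<longrightarrow>
    \<eta> * (1 + x\<^sup>2) \<le> (y - x) * d - X * e"
proof -
  define y where "y = (m1 * \<omega>1 + m2 * \<omega>2) / (m1 + m2)"
  define X where "X = m1 * (y - \<omega>1) / (\<beta>2 - \<beta>1)"
  have y: "y * (m1 + m2) = m1 * \<omega>1 + m2 * \<omega>2"
    using m by (simp add: y_def)
  have "\<omega>1 < y" "y < \<omega>2"
    using ord m by (simp_all add: y_def field_simps)
  note ys = this
  have d: "\<beta>2 - \<beta>1 > 0" using ord by simp
  have X: "X * (\<beta>2 - \<beta>1) = m1 * (y - \<omega>1)"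
    using d by (simp add: X_def)
  also have "\<dots> = m2 * (\<omega>2 - y)"
    using y by (simp add: algebra_simps)
  finally have X': "X * (\<beta>2 - \<beta>1) = m2 * (\<omega>2 - y)" .
  have Xpos: "X > 0" using ys m d by (simp add: X_def)
  obtain \<eta>1 where \<eta>1: "\<eta>1 > 0"
    "\<And>x. \<eta>1 * (1 + x\<^sup>2) \<le> m1 * ((x - y) * (x - \<omega>1)) - X * ((x - \<beta>1) * (x - \<beta>2))"
    using interlacing_form_uniform[OF ord(1) ys(1) _ m(1) X] ys ord by force
  obtain \<eta>2 where \<eta>2: "\<eta>2 > 0"
    "\<And>x. \<eta>2 * (1 + x\<^sup>2) \<le> m2 * ((x - \<omega>2) * (x - y)) - X * ((x - \<beta>1) * (x - \<beta>2))"
    using interlacing_form_uniform[OF _ ys(2) ord(3) m(2) X'] ys ord by force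
  define \<eta> where "\<eta> = min \<eta>1 \<eta>2"
  have "\<eta> * (1 + x\<^sup>2) \<le> (y - x) * d - X * e"
    if e: "e \<le> (x - \<beta>1) * (x - \<beta>2)" and d: "m1 * (\<omega>1 - x) \<le> d" "d \<le> m2 * (\<omega>2 - x)" for x e d
  proof -
    have Xe: "X * e \<le> X * ((x - \<beta>1) * (x - \<beta>2))"
      using e Xpos by simp
    have min: "\<eta> * (1 + x\<^sup>2) \<le> \<eta>1 * (1 + x\<^sup>2)" "\<eta> * (1 + x\<^sup>2) \<le> \<eta>2 * (1 + x\<^sup>2)"
      by (auto simp: \<eta>_def intro!: mult_right_mono)
    show ?thesis
    proof (cases "x \<le> y")
      case True
      then have "(y - x) * (m1 * (\<omega>1 - x)) \<le> (y - x) * d"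
        using d by (intro mult_left_mono) auto
      moreover have "(y - x) * (m1 * (\<omega>1 - x)) = m1 * ((x - y) * (x - \<omega>1))"
        by (simp add: algebra_simps)
      ultimately show ?thesis using \<eta>1(2)[of x] Xe min by linarith
    next
      case False
      then have "(y - x) * (m2 * (\<omega>2 - x)) \<le> (y - x) * d"
        using d by (intro mult_left_mono_neg) auto
      moreover have "(y - x) * (m2 * (\<omega>2 - x)) = m2 * ((x - \<omega>2) * (x - y))"
        by (simp add: algebra_simps)
      ultimately show ?thesis using \<eta>2(2)[of x] Xe min by linarith
    qed
  qed
  moreover have "\<eta> > 0" using \<eta>1 \<eta>2 by (simp add: \<eta>_def)
  ultimately show ?thesis using Xpos by blast
qed

section \<open>From the certificate to strict positive realness\<close>

text \<open>
  The terms \<open>\<epsilon> s\<^sup>4 + \<epsilon>\<close> contribute \<open>\<epsilon> (1 + x\<^sup>2) (x\<^sup>2 - a2 x + a4)\<close> to the real part. The margin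
  \<open>\<eta> x (1 + x\<^sup>2)\<close> outweighs its only negative term \<open>- \<epsilon> a2 x (1 + x\<^sup>2)\<close>, while \<open>a4 > 0\<close> keeps it
  positive at \<open>x = 0\<close>.
\<close>
lemma strictly_positive_real_quartic:
  assumes stable: "hurwitz_stable (monic_quartic a1 a2 a3 a4)" and \<epsilon>: "\<epsilon> > 0"
    and small: "\<epsilon> * a2 \<le> \<eta>"
    and bound: "\<And>x. x \<ge> 0 \<Longrightarrow> \<eta> * (1 + x\<^sup>2) \<le> (y - x) * (a3 - a1 * x) - X * (x\<^sup>2 - a2 * x + a4)"
  shows "strictly_positive_real [:\<epsilon>, y, X, 1, \<epsilon>:] (monic_quartic a1 a2 a3 a4)"
  unfolding strictly_positive_real_def
proof (intro conjI allI stable)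
  let ?a = "monic_quartic a1 a2 a3 a4" and ?b = "[:\<epsilon>, y, X, 1, \<epsilon>:]"
  show "degree ?b = degree ?a" using \<epsilon> by (simp add: monic_quartic_def)
  fix w :: real
  define x where "x = w\<^sup>2"
  define e where "e = x\<^sup>2 - a2 * x + a4"
  define d where "d = a3 - a1 * x"
  let ?s = "\<i> * complex_of_real w"
  have x: "x \<ge> 0" by (simp add: x_def)
  have a4: "a4 > 0" using hurwitz_stable_quartic[OF stable] by simp
  have a: "poly (cpoly ?a) ?s = Complex e (w * d)"
    by (simp add: monic_quartic_def cpoly_pCons complex_eq_iff e_def d_def x_def
        power2_eq_square algebra_simps)
  have b: "poly (cpoly ?b) ?s = Complex (\<epsilon> * (1 + x\<^sup>2) - X * x) (w * (y - x))"
    by (simp add: cpoly_pCons complex_eq_iff x_def power2_eq_square algebra_simps)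
  have "Complex e (w * d) \<noteq> 0"
    using stable a unfolding hurwitz_stable_def by force
  then have den: "e\<^sup>2 + (w * d)\<^sup>2 > 0"
    by (simp add: complex_eq_iff sum_power2_gt_zero_iff)
  have "1 + x\<^sup>2 > 0" "x\<^sup>2 + a4 > 0"
    using a4 by (simp_all add: add_pos_nonneg add_nonneg_pos)
  then have "0 < (1 + x\<^sup>2) * (\<epsilon> * (x\<^sup>2 + a4) + (\<eta> - \<epsilon> * a2) * x)"
    using \<epsilon> small x by (auto intro!: mult_pos_pos add_pos_nonneg[OF mult_pos_pos] mult_nonneg_nonneg)
  also have "\<dots> = x * (\<eta> * (1 + x\<^sup>2)) + \<epsilon> * (1 + x\<^sup>2) * e"
    by (simp add: e_def algebra_simps)
  also have "\<dots> \<le> x * ((y - x) * d - X * e) + \<epsilon> * (1 + x\<^sup>2) * e"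
    using bound[OF x] x by (simp add: mult_left_mono e_def d_def)
  also have "\<dots> = (\<epsilon> * (1 + x\<^sup>2) - X * x) * e + (w * (y - x)) * (w * d)"
    by (simp add: x_def power2_eq_square algebra_simps)
  finally have num: "(\<epsilon> * (1 + x\<^sup>2) - X * x) * e + (w * (y - x)) * (w * d) > 0" .
  show "Re (poly (cpoly ?b) ?s / poly (cpoly ?a) ?s) > 0"
    unfolding a b Re_divide using num den by simp
qed

lemma monic_quartic_in_interval_family:
  assumes "c1 \<in> {lo 1..hi 1}" "c2 \<in> {lo 2..hi 2}" "c3 \<in> {lo 3..hi 3}" "c4 \<in> {lo 4..hi 4}"
  shows "monic_quartic c1 c2 c3 c4 \<in> interval_family lo hi"
proof -
  let ?c = "\<lambda>i::nat. if i = 1 then c1 else if i = 2 then c2 else if i = 3 then c3 else c4"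
  have "?c i \<in> {lo i..hi i}" if "i \<in> {1..4}" for i
  proof -
    have "i = 1 \<or> i = 2 \<or> i = 3 \<or> i = 4" using that by auto
    then show ?thesis using assms by auto
  qed
  moreover have "monic_quartic c1 c2 c3 c4 = monic_quartic (?c 1) (?c 2) (?c 3) (?c 4)"
    by simp
  ultimately show ?thesis
    unfolding interval_family_def mem_Collect_eq by (intro exI[of _ ?c]) blast
qed

text \<open>
  The certificate needs \<open>\<omega>1 < \<omega>2\<close>, but the zeros of the extreme odd parts coincide when the
  intervals of \<open>a1\<close> and \<open>a3\<close> are single points. As the zeros of the even part enclose them
  strictly, \<open>\<omega>1\<close> can be taken a little below the smaller zero \<open>\<rho>\<close>.
\<close>
lemma interval_spr_synthesis:
  fixes lo hi :: "nat \<Rightarrow> real"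
  assumes le: "\<And>i. i \<in> {1..4} \<Longrightarrow> lo i \<le> hi i"
    and stable: "\<And>a. a \<in> interval_family lo hi \<Longrightarrow> hurwitz_stable a"
  shows "\<exists>b. \<forall>a \<in> interval_family lo hi. strictly_positive_real b a"
proof -
  have les: "lo 1 \<le> hi 1" "lo 2 \<le> hi 2" "lo 3 \<le> hi 3" "lo 4 \<le> hi 4"
    using le by simp_all
  have "hurwitz_stable (monic_quartic (lo 1) (lo 2) (hi 3) (hi 4))"
    using les by (intro stable monic_quartic_in_interval_family) auto
  note k2 = hurwitz_stable_quartic[OF this]
  have "hurwitz_stable (monic_quartic (hi 1) (lo 2) (lo 3) (hi 4))"
    using les by (intro stable monic_quartic_in_interval_family) auto
  note k3 = hurwitz_stable_quartic[OF this]
  \<comment> \<open>the largest even part on \<open>x \<ge> 0\<close>, and the zeros of the two extreme odd parts\<close>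
  define E where "E = (\<lambda>x. x\<^sup>2 - lo 2 * x + hi 4)"
  define \<rho> where "\<rho> = lo 3 / hi 1"
  define \<omega>2 where "\<omega>2 = hi 3 / lo 1"
  have "(hi 1)\<^sup>2 * E \<rho> = (lo 3)\<^sup>2 + (hi 1)\<^sup>2 * hi 4 - hi 1 * lo 2 * lo 3"
    using k3 by (simp add: E_def \<rho>_def field_simps power2_eq_square)
  also have "\<dots> < 0" using k3 by simp
  finally have E\<rho>: "E \<rho> < 0" by (simp add: mult_less_0_iff)
  have "(lo 1)\<^sup>2 * E \<omega>2 = (hi 3)\<^sup>2 + (lo 1)\<^sup>2 * hi 4 - lo 1 * lo 2 * hi 3"
    using k2 by (simp add: E_def \<omega>2_def field_simps power2_eq_square)
  also have "\<dots> < 0" using k2 by simp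
  finally have E\<omega>2: "E \<omega>2 < 0" by (simp add: mult_less_0_iff)
  have "\<rho> \<le> \<omega>2"
    unfolding \<rho>_def \<omega>2_def using k2 k3 les by (intro frac_le) auto
  define D where "D = sqrt ((lo 2)\<^sup>2 - 4 * hi 4)"
  have "4 * E \<rho> = (2 * \<rho> - lo 2)\<^sup>2 - ((lo 2)\<^sup>2 - 4 * hi 4)"
    by (simp add: E_def power2_eq_square algebra_simps)
  then have "(lo 2)\<^sup>2 - 4 * hi 4 > 0"
    using E\<rho> zero_le_power2[of "2 * \<rho> - lo 2"] by linarith
  then have D: "D > 0" "D * D = lo 2 * lo 2 - 4 * hi 4"
    by (simp_all add: D_def power2_eq_square)
  define \<beta>1 \<beta>2 where "\<beta>1 = (lo 2 - D) / 2" and "\<beta>2 = (lo 2 + D) / 2"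
  have E: "E x = (x - \<beta>1) * (x - \<beta>2)" for x
    using D(2) by (simp add: E_def \<beta>1_def \<beta>2_def field_simps power2_eq_square)
  have "\<beta>1 < \<beta>2" using D by (simp add: \<beta>1_def \<beta>2_def)
  then have between: "\<beta>1 < x \<and> x < \<beta>2" if "E x < 0" for x
    using that unfolding E mult_less_0_iff by auto
  obtain \<omega>1 where \<omega>1: "\<beta>1 < \<omega>1" "\<omega>1 < \<rho>"
    using between[OF E\<rho>] dense by blast
  have "\<omega>1 < \<omega>2" "\<omega>2 < \<beta>2"
    using \<omega>1 \<open>\<rho> \<le> \<omega>2\<close> between[OF E\<omega>2] by auto
  then obtain X y \<eta> where \<eta>: "\<eta> > 0" and bound: "\<And>x e d.
    e \<le> (x - \<beta>1) * (x - \<beta>2) \<Longrightarrow> hi 1 * (\<omega>1 - x) \<le> d \<Longrightarrow> d \<le> lo 1 * (\<omega>2 - x) \<Longrightarrow>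
    \<eta> * (1 + x\<^sup>2) \<le> (y - x) * d - X * e"
    using common_multiplier[of \<beta>1 \<omega>1 \<omega>2 \<beta>2 "hi 1" "lo 1"] \<omega>1 k2 k3 by blast
  define \<epsilon> where "\<epsilon> = \<eta> / hi 2"
  have hi2: "hi 2 > 0" using k2 les by simp
  have \<epsilon>: "\<epsilon> > 0" "\<epsilon> * hi 2 = \<eta>" using \<eta> hi2 by (simp_all add: \<epsilon>_def)
  have "strictly_positive_real [:\<epsilon>, y, X, 1, \<epsilon>:] a" if a_mem: "a \<in> interval_family lo hi" for a
  proof -
    obtain c where a: "a = monic_quartic (c 1) (c 2) (c 3) (c 4)"
      and c: "\<And>i. i \<in> {1..4} \<Longrightarrow> c i \<in> {lo i..hi i}"
      using a_mem unfolding interval_family_def by blast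
    have cs: "lo 1 \<le> c 1" "c 1 \<le> hi 1" "lo 2 \<le> c 2" "c 2 \<le> hi 2"
      "lo 3 \<le> c 3" "c 3 \<le> hi 3" "c 4 \<le> hi 4"
      using c[of 1] c[of 2] c[of 3] c[of 4] by simp_all
    show ?thesis
      unfolding a
    proof (rule strictly_positive_real_quartic[OF _ \<epsilon>(1)])
      show "hurwitz_stable (monic_quartic (c 1) (c 2) (c 3) (c 4))"
        using stable a_mem a by simp
      show "\<epsilon> * c 2 \<le> \<eta>"
        using \<epsilon> cs by (metis less_imp_le mult_left_mono)
      fix x :: real
      assume x: "x \<ge> 0"
      show "\<eta> * (1 + x\<^sup>2) \<le> (y - x) * (c 3 - c 1 * x) - X * (x\<^sup>2 - c 2 * x + c 4)"
      proof (rule bound)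
        have "lo 2 * x \<le> c 2 * x" using cs x by (intro mult_right_mono)
        then have "x\<^sup>2 - c 2 * x + c 4 \<le> E x" using cs by (simp add: E_def)
        then show "x\<^sup>2 - c 2 * x + c 4 \<le> (x - \<beta>1) * (x - \<beta>2)" by (simp only: E)
        have "hi 1 * \<omega>1 \<le> hi 1 * \<rho>" using \<omega>1 k3 by simp
        also have "\<dots> = lo 3" using k3 by (simp add: \<rho>_def)
        finally have "hi 1 * \<omega>1 \<le> c 3" using cs by simp
        moreover have "c 1 * x \<le> hi 1 * x" using cs x by (intro mult_right_mono)
        ultimately show "hi 1 * (\<omega>1 - x) \<le> c 3 - c 1 * x" by (simp add: algebra_simps)
        have "lo 1 * \<omega>2 = hi 3" using k2 by (simp add: \<omega>2_def)
        moreover have "lo 1 * x \<le> c 1 * x" using cs x by (intro mult_right_mono)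
        ultimately show "c 3 - c 1 * x \<le> lo 1 * (\<omega>2 - x)"
          using cs by (simp add: algebra_simps)
      qed
    qed
  qed
  then show ?thesis by blast
qed

theorem theorem4:
  fixes lo hi :: "nat \<Rightarrow> real"
  assumes "\<And>i. i \<in> {1..4} \<Longrightarrow> lo i \<le> hi i"
    and "\<And>a. a \<in> interval_family lo hi \<Longrightarrow> hurwitz_stable a"
  shows "\<exists>b :: real poly. \<forall>a \<in> kharitonov_vertices lo hi. strictly_positive_real b a"
proof -
  have "lo 1 \<le> hi 1" "lo 2 \<le> hi 2" "lo 3 \<le> hi 3" "lo 4 \<le> hi 4"
    using assms(1) by simp_all
  then have "kharitonov_vertices lo hi \<subseteq> interval_family lo hi"
    unfolding kharitonov_vertices_def by (auto intro!: monic_quartic_in_interval_family)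
  moreover have "\<exists>b. \<forall>a \<in> interval_family lo hi. strictly_positive_real b a"
    by (rule interval_spr_synthesis) (use assms in auto)
  ultimately show ?thesis by blast
qed

end
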